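(* Let $\rho,\lambda$ be positive reals with $\rho+\lambda<1$, and let $\beta\ge 1$ be an integer. If algorithm JRRW($J$) is executed by $n$ stations, on a multiple access channel with jamming and without collision detection, against a leaky-bucket jamming adversary of type $(\rho,\lambda,\beta)$ whose jamming burstiness is at most $J$, then the number of packets stored in the queues in any round is at most $$\frac{2(\beta+1)}{1-\rho-\lambda}\cdot n+\beta$$ and packet latency is at most $$\frac{2(\beta+1)}{(1-\lambda)(1-\rho-\lambda)^2}\cdot n+\frac{\beta(1-\lambda)}{1-\rho-\lambda}.$$
   Context: Channel. There are $n$ stations with distinct names $0,1,\dots,n-1$ attached to a shared channel; $n$ and own names are known to the stations. Time is divided into synchronous rounds numbered from $0$; all stations start in round $0$ with empty queues. In each round each station either transmits one message (containing at most one packet) or pauses. Some rounds may be jammed. A message is heard (by all stations) in a round iff it is the only message transmitted in that round and the round is not jammed. A round is void if no message is heard; without collision detection stations cannot tell the cause of voidness (silence, collision, or jamming). All stations get the same feedback. Within a round the order is: transmissions, feedback, injection of new packets (enqueued into private unbounded FIFO queues), local state change. A packet is removed from its queue once heard; a packet transmitted but not heard is transmitted again in the next round in which its station is scheduled to transmit. Jamming adversary of type $(\rho,\lambda,\beta)$: in each contiguous segment of $t>0$ rounds it injects at most $\rho t+\beta$ packets, into arbitrary stations, and, independently, jams at most $\lambda t+\beta$ rounds. Its jamming burstiness is the maximum number of consecutive rounds it can jam. Packet latency: an upper bound on the number of rounds a packet spends waiting in a queue, counted from the round of injection through the round in which it is heard. The number of packets stored in the queues is the total over all stations. Algorithm JRRW($J$)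 (Jamming-Round-Robin-Withholding): the integer $J$ is a parameter that is part of the code, interpreted as an upper bound on the jamming burstiness of the adversary. A conceptual token visits the stations in the cyclic order of names, starting at station $0$ in round $0$. Only the station holding the token transmits; it transmits the packets in its queue, one per round, as long as the queue is nonempty, and otherwise pauses. Each station maintains a counter (identical in all stations), initially $0$, which is incremented by $1$ in each void round and is reset to $0$ whenever a packet is heard or the token is moved. The token moves to the next station when the counter reaches $J+1$.
   Formalization: The bounds fail for large J, so J ≤ β/(1−λ) is assumed; and a token holder that has found its queue empty pauses for the rest of that visit, since resuming on newly injected packets would let an adversary keep the token at one station forever. *)

theory Defs
  imports Complex_Main
begin

(* The packet (r, i, k) is the k-th of the packets injected into station i in round r. *)
type_synonym packet = "nat \<times> nat \<times> nat"

(* An adversary's behaviour: the number of packets injected per round and station, and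
   the set of jammed rounds. *)
type_synonym injections = "nat \<Rightarrow> nat \<Rightarrow> nat"
type_synonym jamming = "nat \<Rightarrow> bool"

definition adversary_of_type ::
    "nat \<Rightarrow> real \<Rightarrow> real \<Rightarrow> nat \<Rightarrow> injections \<Rightarrow> jamming \<Rightarrow> bool" where
  "adversary_of_type n \<rho> lam \<beta> inject jam \<longleftrightarrow>
     (\<forall>s t. t > 0 \<longrightarrow>
        real (\<Sum>r = s..<s + t. \<Sum>i<n. inject r i) \<le> \<rho> * real t + real \<beta> \<and>
        real (card {r \<in> {s..<s + t}. jam r}) \<le> lam * real t + real \<beta>)"

definition jamming_burstiness_at_most :: "jamming \<Rightarrow> nat \<Rightarrow> bool" where
  "jamming_burstiness_at_most jam J \<longleftrightarrow>
     (\<forall>s t. (\<forall>r \<in> {s..<s + t}. jam r) \<longrightarrow> t \<le> J)"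

definition channel :: "nat \<Rightarrow> (nat \<Rightarrow> packet option) \<Rightarrow> bool \<Rightarrow> packet option" where
  "channel n tx jammed =
     (if \<not> jammed \<and> (\<exists>!i. i < n \<and> tx i \<noteq> None)
      then tx (THE i. i < n \<and> tx i \<noteq> None) else None)"

(* The void-round counters of the stations all agree, so there is one of them.
   The flag drained is set once the token holder has found its queue empty during the
   current visit of the token; from then on it pauses until the token leaves, also if
   new packets arrive.  Without the flag, a packet injected into the holder after up to
   J silent rounds would be heard and reset the counter, so that an adversary with
   injection rate above 1/(J+1) could keep the token at one station for ever and let
   the other queues grow without bound. *)
record jrrw_state =
  token :: nat
  counter :: nat
  drained :: bool
  queue :: "nat \<Rightarrow> packet list"

definition init_state :: jrrw_state where
  "init_state = \<lparr>token = 0, counter = 0, drained = False, queue = (\<lambda>i. [])\<rparr>"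

definition transmission :: "jrrw_state \<Rightarrow> nat \<Rightarrow> packet option" where
  "transmission s i =
     (if i = token s \<and> \<not> drained s \<and> queue s i \<noteq> []
      then Some (hd (queue s i)) else None)"

definition new_packets :: "injections \<Rightarrow> nat \<Rightarrow> nat \<Rightarrow> packet list" where
  "new_packets inject r i = map (\<lambda>k. (r, i, k)) [0..<inject r i]"

definition jrrw_step ::
    "nat \<Rightarrow> nat \<Rightarrow> (nat \<Rightarrow> packet list) \<Rightarrow> bool \<Rightarrow> jrrw_state \<Rightarrow> jrrw_state" where
  "jrrw_step n J new jammed s =
     (let h = channel n (transmission s) jammed;
          q = (\<lambda>i. (if h \<noteq> None \<and> transmission s i = h then tl (queue s i) else queue s i)
                    @ new i);
          c = (if h = None then Suc (counter s) else 0)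
      in if c = J + 1
         then \<lparr>token = (token s + 1) mod n, counter = 0, drained = False, queue = q\<rparr>
         else \<lparr>token = token s, counter = c,
               drained = (drained s \<or> queue s (token s) = []), queue = q\<rparr>)"

(* The state at the beginning of round r, that is, after the injections of round r - 1. *)
primrec jrrw :: "nat \<Rightarrow> nat \<Rightarrow> injections \<Rightarrow> jamming \<Rightarrow> nat \<Rightarrow> jrrw_state" where
  "jrrw n J inject jam 0 = init_state"
| "jrrw n J inject jam (Suc r) =
     jrrw_step n J (new_packets inject r) (jam r) (jrrw n J inject jam r)"

definition heard :: "nat \<Rightarrow> nat \<Rightarrow> injections \<Rightarrow> jamming \<Rightarrow> nat \<Rightarrow> packet option" where
  "heard n J inject jam r = channel n (transmission (jrrw n J inject jam r)) (jam r)"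

definition stored_packets :: "nat \<Rightarrow> jrrw_state \<Rightarrow> nat" where
  "stored_packets n s = (\<Sum>i<n. length (queue s i))"

(* Every packet is heard, and both the round of injection and the round in which the
   packet is heard are counted. *)
definition packet_latency_at_most ::
    "nat \<Rightarrow> nat \<Rightarrow> injections \<Rightarrow> jamming \<Rightarrow> real \<Rightarrow> bool" where
  "packet_latency_at_most n J inject jam L \<longleftrightarrow>
     (\<forall>r i k. i < n \<longrightarrow> k < inject r i \<longrightarrow>
        (\<exists>r' \<ge> r. heard n J inject jam r' = Some (r, i, k) \<and> real (r' - r + 1) \<le> L))"

end

theory Submission
  imports Defs
begin

text \<open>
  Let \<open>D v\<close> be the round in which the holder finds its queue empty during the \<open>v\<close>-th visit of the
  token.  Every visit has exactly \<open>J + 1\<close> silent rounds, so at most \<open>n (J + 1)\<close> rounds between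
  \<open>D (v - n)\<close> and \<open>D v\<close> are silent, and every other round in between is jammed or removes a
  packet.  With \<open>K = 2 \<beta> + n (J + 1)\<close>, \<open>\<delta> = 1 - \<rho> - \<lambda>\<close> and \<open>Q\<close> the number of stored packets this
  gives \<open>Q (D v) \<le> Q (D (v - n)) + K - \<delta> T\<close> for a cycle of length \<open>T\<close>.  As all stations are
  emptied once in the cycle, also \<open>Q (D v) \<le> \<rho> T + \<beta>\<close>.  Eliminating \<open>T\<close> yields a contraction with
  ratio \<open>\<rho> / (1 - \<lambda>)\<close> and fixed point \<open>\<rho> K / \<delta> + \<beta>\<close>.  A packet waits for at most one cycle.
  Truncated subtraction makes the cycle start at \<open>D 0 = 0\<close> for \<open>v < n\<close>, when all queues are empty.
  For a single station the fixed point is too weak, but there \<open>Q (D v) = 0\<close>.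
\<close>

text \<open>Separates the two causes of voidness: a round is void iff it is jammed or silent. A
  holder with \<open>drained\<close> set is silent even if packets have arrived in the
  meantime.\<close>

definition silent :: "jrrw_state \<Rightarrow> bool" where
  "silent s \<longleftrightarrow> drained s \<or> queue s (token s) = []"

text \<open>Only the token holder can transmit, so collisions never occur and jamming is the only
  way to lose a transmission.\<close>

lemma channel_transmission:
  assumes "token s < n"
  shows "channel n (transmission s) jammed =
    (if jammed \<or> silent s then None else Some (hd (queue s (token s))))"
proof (cases "silent s")
  case True
  then have "transmission s i = None" for i
    by (auto simp: transmission_def silent_def)
  then show ?thesis using True by (simp add: channel_def)
next
  case False
  then have tr: "transmission s i \<noteq> None \<longleftrightarrow> i = token s" for i
    by (simp add: transmission_def silent_def del: not_None_eq)
  then have "(THE i. i < n \<and> transmission s i \<noteq> None) = token s"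
    "\<exists>!i. i < n \<and> transmission s i \<noteq> None"
    using assms by (auto intro!: the_equality)
  then show ?thesis using False
    by (auto simp: channel_def transmission_def silent_def)
qed

declare jrrw.simps [simp del]

section \<open>Single rounds of an execution\<close>

locale jrrw_execution =
  fixes n J \<beta> :: nat and \<rho> lam :: real
    and inject :: injections and jam :: jamming
  assumes n_pos: "n \<ge> 1"
    and rho_pos: "\<rho> > 0" and lam_pos: "lam > 0" and rate: "\<rho> + lam < 1"
    and adversary: "adversary_of_type n \<rho> lam \<beta> inject jam"
    and burstiness: "jamming_burstiness_at_most jam J"
begin

abbreviation st :: "nat \<Rightarrow> jrrw_state" where
  "st \<equiv> jrrw n J inject jam"

abbreviation Q :: "nat \<Rightarrow> nat" where
  "Q r \<equiv> stored_packets n (st r)"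

definition injected :: "nat \<Rightarrow> nat \<Rightarrow> nat" where
  "injected a b = (\<Sum>r = a..<b. \<Sum>i<n. inject r i)"

definition silence :: "nat \<Rightarrow> nat \<Rightarrow> nat" where
  "silence a b = card {r \<in> {a..<b}. silent (st r)}"

text \<open>Visits of the token are numbered from 0, so visit \<open>v\<close> belongs to station
  \<open>v mod n\<close>. Counter 0 and the unset flag mark \<open>d\<close> as the first silent
  round of the visit, with the full count to \<open>J + 1\<close> still ahead.\<close>

definition visit_drained :: "nat \<Rightarrow> nat \<Rightarrow> bool" where
  "visit_drained v d \<longleftrightarrow> token (st d) = v mod n \<and> counter (st d) = 0 \<and>
     \<not> drained (st d) \<and> queue (st d) (v mod n) = []"

lemma token_less: "token (st r) < n"
  using n_pos by (induction r) (auto simp: jrrw.simps init_state_def jrrw_step_def Let_def)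

lemma heard_eq:
  "heard n J inject jam r =
    (if jam r \<or> silent (st r) then None else Some (hd (queue (st r) (token (st r)))))"
  by (simp add: heard_def channel_transmission token_less)

lemma queue_Suc:
  "queue (st (Suc r)) i =
    (if i = token (st r) \<and> \<not> jam r \<and> \<not> silent (st r) then tl (queue (st r) i)
     else queue (st r) i) @ new_packets inject r i"
  by (auto simp: jrrw.simps jrrw_step_def Let_def channel_transmission token_less transmission_def
      silent_def simp del: not_None_eq)

lemma control_Suc_void:
  assumes "jam r \<or> silent (st r)"
  shows "token (st (Suc r)) =
      (if counter (st r) = J then (token (st r) + 1) mod n else token (st r))"
    and "counter (st (Suc r)) = (if counter (st r) = J then 0 else Suc (counter (st r)))"
    and "drained (st (Suc r)) \<longleftrightarrow> counter (st r) \<noteq> J \<and> silent (st r)"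
  using assms
  by (auto simp: jrrw.simps jrrw_step_def Let_def channel_transmission token_less silent_def)

lemma control_Suc_heard:
  assumes "\<not> jam r" "\<not> silent (st r)"
  shows "token (st (Suc r)) = token (st r)"
    and "counter (st (Suc r)) = 0"
    and "\<not> drained (st (Suc r))"
  using assms
  by (auto simp: jrrw.simps jrrw_step_def Let_def channel_transmission token_less silent_def)

section \<open>Balance of injected and heard packets\<close>

lemma injected_Suc: "a \<le> b \<Longrightarrow> injected a (Suc b) = injected a b + (\<Sum>i<n. inject b i)"
  by (simp add: injected_def)

lemma injected_le: "a \<le> b \<Longrightarrow> real (injected a b) \<le> \<rho> * real (b - a) + real \<beta>"
  using adversary[unfolded adversary_of_type_def, rule_format, of "b - a" a]
  by (cases "a = b") (auto simp: injected_def)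

lemma jammed_le:
  "a \<le> b \<Longrightarrow> real (card {r \<in> {a..<b}. jam r}) \<le> lam * real (b - a) + real \<beta>"
  using adversary[unfolded adversary_of_type_def, rule_format, of "b - a" a]
  by (cases "a = b") auto

lemma card_round_Suc:
  "a \<le> b \<Longrightarrow> card {r \<in> {a..<Suc b}. P r} = card {r \<in> {a..<b}. P r} + (if P b then 1 else 0)"
proof -
  assume "a \<le> b"
  then have "{r \<in> {a..<Suc b}. P r} = (if P b then {b} else {}) \<union> {r \<in> {a..<b}. P r}"
    by (auto simp: less_Suc_eq)
  then show ?thesis by simp
qed

lemma stored_Suc:
  "Q (Suc r) + (if jam r \<or> silent (st r) then 0 else 1) = Q r + (\<Sum>i<n. inject r i)"
proof (cases "jam r \<or> silent (st r)")
  case True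
  then show ?thesis
    by (auto simp: stored_packets_def queue_Suc new_packets_def sum.distrib)
next
  case False
  let ?t = "token (st r)"
  have "length (queue (st (Suc r)) i) + (if i = ?t then 1 else 0)
      = length (queue (st r) i) + inject r i" for i
    using False by (cases "queue (st r) i") (auto simp: queue_Suc new_packets_def silent_def)
  then have "(\<Sum>i<n. length (queue (st (Suc r)) i) + (if i = ?t then 1 else 0))
      = (\<Sum>i<n. length (queue (st r) i) + inject r i)"
    by simp
  then show ?thesis using False token_less[of r]
    by (simp add: stored_packets_def sum.distrib sum.delta)
qed

text \<open>Every round is jammed, is silent, or removes a packet. This is only an inequality,
  because a round both jammed and silent is counted twice on the right.\<close>

lemma conservation:
  assumes "a \<le> b"
  shows "Q b + (b - a) \<le> Q a + injected a b + card {r \<in> {a..<b}. jam r} + silence a b"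
  using assms
proof (induction b rule: dec_induct)
  case base
  then show ?case by simp
next
  case (step m)
  then show ?case
    using stored_Suc[of m]
    unfolding silence_def injected_Suc[OF step.hyps(1)] card_round_Suc[OF step.hyps(1)]
    by (auto split: if_splits)
qed

text \<open>Apart from silent rounds the store drifts down at rate \<open>1 - \<rho> - lam\<close>.
  The term \<open>2 * real \<beta>\<close> collects one burst of injections and one of
  jamming.\<close>

lemma stored_le:
  assumes "a \<le> b"
  shows "real (Q b) \<le> real (Q a) + 2 * real \<beta> + real (silence a b) - (1 - \<rho> - lam) * real (b - a)"
proof -
  have "real (Q b) + real (b - a)
      \<le> real (Q a) + real (injected a b) + real (card {r \<in> {a..<b}. jam r}) + real (silence a b)"
    using conservation[OF assms] by linarith
  then show ?thesis using injected_le[OF assms] jammed_le[OF assms]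
    by (simp add: algebra_simps)
qed

section \<open>Silent rounds and visits of the token\<close>

lemma silence_mono: "b \<le> c \<Longrightarrow> silence a b \<le> silence a c"
  unfolding silence_def by (intro card_mono) auto

lemma silence_add:
  assumes "a \<le> b" "b \<le> c"
  shows "silence a c = silence a b + silence b c"
proof -
  have "{r \<in> {a..<c}. silent (st r)} = {r \<in> {a..<b}. silent (st r)} \<union> {r \<in> {b..<c}. silent (st r)}"
    using assms by auto
  then show ?thesis unfolding silence_def by (simp add: card_Un_disjoint disjoint_iff)
qed

text \<open>Once the empty queue has been seen, \<open>drained\<close> keeps the rounds silent
  whatever is injected, so the counter rises by one per round and jamming has no further
  effect.\<close>

lemma silent_rounds:
  assumes "visit_drained v d" "k \<le> J"
  shows "token (st (d + k)) = v mod n \<and> counter (st (d + k)) = k \<and> silent (st (d + k))"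
  using assms(2)
proof (induction k)
  case 0
  then show ?case using assms(1) by (simp add: visit_drained_def silent_def)
next
  case (Suc k)
  then have "silent (st (d + k))" "counter (st (d + k)) = k" "token (st (d + k)) = v mod n" "k \<noteq> J"
    by auto
  then show ?case
    using control_Suc_void[of "d + k"] by (simp add: silent_def)
qed

text \<open>In a busy visit the void rounds are the jammed ones, so the token could only leave after
  \<open>J + 1\<close> consecutive jammed rounds.\<close>

lemma busy_round:
  assumes "\<And>r. e \<le> r \<Longrightarrow> r < e + k \<Longrightarrow> queue (st r) t \<noteq> []"
    and "token (st e) = t" "counter (st e) = 0" "\<not> drained (st e)"
  shows "token (st (e + k)) = t \<and> \<not> drained (st (e + k)) \<and> counter (st (e + k)) \<le> k \<and>
    (\<forall>r \<in> {e + k - counter (st (e + k))..<e + k}. jam r) \<and>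
    (\<forall>r \<in> {e..<e + k}. \<not> silent (st r))"
  using assms(1)
proof (induction k)
  case 0
  then show ?case using assms by simp
next
  case (Suc k)
  then have IH: "token (st (e + k)) = t" "\<not> drained (st (e + k))" "counter (st (e + k)) \<le> k"
    "\<forall>r \<in> {e + k - counter (st (e + k))..<e + k}. jam r" "\<forall>r \<in> {e..<e + k}. \<not> silent (st r)"
    by auto
  have active: "\<not> silent (st (e + k))"
    using Suc.prems[of "e + k"] IH by (simp add: silent_def)
  with IH(5) have all: "\<forall>r \<in> {e..<e + Suc k}. \<not> silent (st r)"
    by (auto simp: less_Suc_eq)
  show ?case
  proof (cases "jam (e + k)")
    case False
    then show ?thesis using control_Suc_heard[OF False active] IH all
      by simp
  next
    case True
    \<comment> \<open>The last \<open>?c\<close> rounds were all jammed. Together with the present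
      one they form a run of length \<open>Suc ?c\<close>, which the burstiness bounds by
      \<open>J\<close>. The bound \<open>?c \<le> k\<close> makes the subtraction exact.\<close>
    let ?c = "counter (st (e + k))"
    have jams: "\<forall>r \<in> {e + k - ?c..<Suc (e + k)}. jam r"
      using IH(4) True by (auto simp: less_Suc_eq)
    moreover have "Suc (e + k) = e + k - ?c + Suc ?c" using IH(3) by simp
    ultimately have "Suc ?c \<le> J"
      using burstiness unfolding jamming_burstiness_at_most_def by metis
    then have "?c \<noteq> J" by simp
    then show ?thesis using control_Suc_void[of "e + k"] True active IH all jams
      by simp
  qed
qed

text \<open>After \<open>J + 1\<close> silent rounds the token reaches the next station. Its queue
  must run empty: a visit that stayed busy for ever would have no silent rounds, and the drift would
  make the store negative.\<close>

lemma next_visit: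
  assumes "visit_drained v d"
  shows "\<exists>d'. visit_drained (Suc v) d' \<and> d < d' \<and> silence d d' = J + 1"
proof -
  define e where "e = Suc (d + J)"
  define t where "t = Suc v mod n"
  have e: "token (st e) = t" "counter (st e) = 0" "\<not> drained (st e)"
    using silent_rounds[OF assms order_refl] control_Suc_void[of "d + J"]
    by (auto simp: e_def t_def mod_Suc_eq)
  have "\<exists>k. queue (st (e + k)) t = []"
  proof (rule ccontr)
    assume "\<not> ?thesis"
    then have ne: "queue (st r) t \<noteq> []" if "e \<le> r" for r
      using that by (metis le_add_diff_inverse)
    obtain k :: nat where k: "real k * (1 - \<rho> - lam) > real (Q e) + 2 * real \<beta>"
      using reals_Archimedean3[of "1 - \<rho> - lam"] rate by auto
    have "{r \<in> {e..<e + k}. silent (st r)} = {}"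
      using busy_round[of e k t] ne e by blast
    then have "silence e (e + k) = 0"
      unfolding silence_def by (metis card.empty)
    then show False using stored_le[of e "e + k"] k by (simp add: mult.commute)
  qed
  \<comment> \<open>Taking the first empty moment keeps the station busy in all earlier rounds of
    the visit.\<close>
  define k where "k = (LEAST k. queue (st (e + k)) t = [])"
  have empty: "queue (st (e + k)) t = []"
    unfolding k_def by (rule LeastI_ex) fact
  have ne: "queue (st r) t \<noteq> []" if "e \<le> r" "r < e + k" for r
    using not_less_Least[of "r - e" "\<lambda>k. queue (st (e + k)) t = []"] that
    unfolding k_def by simp
  note busy = busy_round[of e k t, OF ne e]
  \<comment> \<open>A positive counter would mean that the preceding round was jammed. No packet
    left then, so the queue was empty already, against minimality of \<open>k\<close>.\<close>
  have "counter (st (e + k)) = 0"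
  proof (rule ccontr)
    assume c: "counter (st (e + k)) \<noteq> 0"
    then have "k \<noteq> 0" using busy by auto
    then obtain m where m: "k = Suc m" by (cases k) auto
    have "e + m \<in> {e + k - counter (st (e + k))..<e + k}" using c m by auto
    then have "jam (e + m)" using busy by blast
    then have "queue (st (e + m)) t = []"
      using empty m by (simp add: queue_Suc)
    then show False using ne[of "e + m"] m by simp
  qed
  then have drained: "visit_drained (Suc v) (e + k)"
    using busy empty by (simp add: visit_drained_def t_def)
  have "{r \<in> {d..<e + k}. silent (st r)} = {d..<e}"
  proof (intro equalityI subsetI)
    fix r assume "r \<in> {r \<in> {d..<e + k}. silent (st r)}"
    then show "r \<in> {d..<e}" using busy
      by (metis (mono_tags, lifting) atLeastLessThan_iff mem_Collect_eq not_le)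
  next
    fix r assume r: "r \<in> {d..<e}"
    then have "r - d \<le> J" by (simp add: e_def) linarith
    then have "silent (st (d + (r - d)))"
      using silent_rounds[OF assms, of "r - d"] by blast
    then show "r \<in> {r \<in> {d..<e + k}. silent (st r)}" using r by simp
  qed
  then have "silence d (e + k) = J + 1" by (simp add: silence_def e_def)
  with drained show ?thesis by (intro exI[of _ "e + k"]) (simp add: e_def)
qed

text \<open>Dependent choice along \<open>next_visit\<close>. The initial state, with all queues
  empty, serves as the drained moment of visit 0.\<close>

lemma ex_visits:
  "\<exists>D. D 0 = 0 \<and> (\<forall>v. visit_drained v (D v)) \<and>
    (\<forall>v. D v < D (Suc v) \<and> silence (D v) (D (Suc v)) = J + 1)"
proof -
  have "\<exists>D. \<forall>v. (visit_drained v (D v) \<and> (v = 0 \<longrightarrow> D v = 0)) \<and>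
      (D v < D (Suc v) \<and> silence (D v) (D (Suc v)) = J + 1)"
  proof (rule dependent_nat_choice)
    show "\<exists>d. visit_drained 0 d \<and> (0 = (0::nat) \<longrightarrow> d = 0)"
      by (auto simp: visit_drained_def jrrw.simps init_state_def)
  qed (use next_visit in blast)
  then show ?thesis by blast
qed

definition D :: "nat \<Rightarrow> nat" where
  "D = (SOME D. D 0 = 0 \<and> (\<forall>v. visit_drained v (D v)) \<and>
    (\<forall>v. D v < D (Suc v) \<and> silence (D v) (D (Suc v)) = J + 1))"

lemma D_0: "D 0 = 0"
  and D_drained: "visit_drained v (D v)"
  and D_Suc: "D v < D (Suc v)"
  and silence_D_Suc: "silence (D v) (D (Suc v)) = J + 1"
  using someI_ex[OF ex_visits] unfolding D_def by blast+

lemma strict_mono_D: "strict_mono D"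
  using D_Suc by (simp add: strict_mono_Suc_iff)

lemma D_mono: "v \<le> w \<Longrightarrow> D v \<le> D w"
  using strict_mono_D by (simp add: strict_mono_less_eq)

lemma less_D: "v < D (Suc v)"
  using strict_mono_imp_increasing[OF strict_mono_D, of "Suc v"] by simp

lemma silence_D: "silence (D v) (D (v + k)) = k * (J + 1)"
proof (induction k)
  case 0
  then show ?case by (simp add: silence_def)
next
  case (Suc k)
  then show ?case
    using silence_add[of "D v" "D (v + k)" "D (Suc (v + k))"] D_mono silence_D_Suc by simp
qed

section \<open>Stored packets over a cycle of \<open>n\<close> visits\<close>

lemma silence_cycle:
  assumes "r \<le> D v"
  shows "silence (D (v - n)) r \<le> n * (J + 1)"
proof -
  have "silence (D (v - n)) r \<le> silence (D (v - n)) (D v)"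
    using assms by (rule silence_mono)
  \<comment> \<open>The factor \<open>v - (v - n)\<close> is the smaller of \<open>v\<close> and
    \<open>n\<close>, since the first cycles are cut off at visit 0.\<close>
  also have "\<dots> = (v - (v - n)) * (J + 1)"
    using silence_D[of "v - n" "v - (v - n)"] by simp
  also have "\<dots> \<le> n * (J + 1)"
    by (intro mult_le_mono1) simp
  finally show ?thesis .
qed

lemma cycle_stored_le:
  assumes "D (v - n) \<le> r" "r \<le> D v"
  shows "real (Q r) + (1 - \<rho> - lam) * real (r - D (v - n))
    \<le> real (Q (D (v - n))) + (2 * real \<beta> + real n * (real J + 1))"
proof -
  have "real (silence (D (v - n)) r) \<le> real (n * (J + 1))"
    using silence_cycle[OF assms(2)] by (simp only: of_nat_le_iff)
  then show ?thesis using stored_le[OF assms(1)] by (simp add: algebra_simps)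
qed

lemma queue_le:
  assumes "a \<le> b"
  shows "length (queue (st b) i) \<le> length (queue (st a) i) + (\<Sum>r = a..<b. inject r i)"
  using assms
proof (induction b rule: dec_induct)
  case (step m)
  then show ?case by (auto simp: queue_Suc new_packets_def)
qed simp

lemma queue_init: "queue (st 0) i = []"
  by (simp add: jrrw.simps init_state_def)

text \<open>Each station has an empty queue at some moment of the cycle, so whatever it stores at
  the end was injected during the cycle.\<close>

lemma stored_D_le_injected: "Q (D v) \<le> injected (D (v - n)) (D v)"
proof -
  have "length (queue (st (D v)) i) \<le> (\<Sum>r = D (v - n)..<D v. inject r i)" if i: "i < n" for i
  proof -
    have "\<exists>a. D (v - n) \<le> a \<and> a \<le> D v \<and> queue (st a) i = []"
    proof (cases "v < n")
      case True
      then show ?thesis by (intro exI[of _ 0]) (simp add: D_0 queue_init)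
    next
      case False
      \<comment> \<open>Going back \<open>k < n\<close> visits from \<open>v\<close> leads to the
        latest visit of station \<open>i\<close>.\<close>
      define k where "k = (v - i) mod n"
      have "(v - k) mod n = i"
      proof -
        have "v - k = i + n * ((v - i) div n)"
          using False i minus_mod_eq_mult_div[of "v - i" n] mod_less_eq_dividend[of "v - i" n]
          unfolding k_def by linarith
        then show ?thesis using i by simp
      qed
      moreover have "k < n" using n_pos by (simp add: k_def)
      ultimately show ?thesis
        using D_drained[of "v - k"] by (intro exI[of _ "D (v - k)"]) (auto simp: visit_drained_def D_mono)
    qed
    then obtain a where a: "D (v - n) \<le> a" "a \<le> D v" "queue (st a) i = []" by blast
    have "length (queue (st (D v)) i) \<le> (\<Sum>r = a..<D v. inject r i)"
      using queue_le[OF a(2), of i] a(3) by simp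
    also have "\<dots> \<le> (\<Sum>r = D (v - n)..<D v. inject r i)"
      using a(1) by (intro sum_mono2) auto
    finally show ?thesis .
  qed
  then have "Q (D v) \<le> (\<Sum>i<n. \<Sum>r = D (v - n)..<D v. inject r i)"
    unfolding stored_packets_def by (intro sum_mono) simp
  also have "\<dots> = injected (D (v - n)) (D v)"
    unfolding injected_def by (rule sum.swap)
  finally show ?thesis .
qed

lemma stored_D_le:
  "real (Q (D v)) \<le>
    \<rho> * (2 * real \<beta> + real n * (real J + 1)) / (1 - \<rho> - lam) + real \<beta>"
proof (induction v rule: less_induct)
  case (less v)
  define K where "K = 2 * real \<beta> + real n * (real J + 1)"
  define B where "B = \<rho> * K / (1 - \<rho> - lam) + real \<beta>"
  define T where "T = real (D v - D (v - n))"
  have pos: "1 - \<rho> - lam > 0" "K \<ge> 0" using rate by (auto simp: K_def)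
  then have "B \<ge> 0" using rho_pos by (simp add: B_def)
  have "real (Q (D (v - n))) \<le> B"
  proof (cases "v = 0")
    case True
    then show ?thesis using \<open>B \<ge> 0\<close> by (simp add: D_0 stored_packets_def queue_init)
  next
    case False
    then show ?thesis using less[of "v - n"] n_pos by (simp add: B_def K_def)
  qed
  moreover have "real (Q (D v)) + (1 - \<rho> - lam) * T \<le> real (Q (D (v - n))) + K"
    using cycle_stored_le[of v "D v"] D_mono[of "v - n" v] by (simp add: T_def K_def)
  ultimately have "real (Q (D v)) + (1 - \<rho> - lam) * T \<le> B + K" by linarith
  \<comment> \<open>The weights \<open>\<rho>\<close> here and \<open>1 - \<rho> - lam\<close> in
    the second bound are chosen so that \<open>T\<close> cancels. They add up to
    \<open>1 - lam\<close>.\<close>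
  then have 1: "\<rho> * (real (Q (D v)) + (1 - \<rho> - lam) * T) \<le> \<rho> * (B + K)"
    using rho_pos by simp
  have "real (Q (D v)) \<le> \<rho> * T + real \<beta>"
    using stored_D_le_injected[of v] injected_le[of "D (v - n)" "D v"] D_mono[of "v - n" v]
    by (simp add: T_def)
  then have 2: "(1 - \<rho> - lam) * real (Q (D v)) \<le> (1 - \<rho> - lam) * (\<rho> * T + real \<beta>)"
    using pos by simp
  have "(1 - \<rho> - lam) * B = \<rho> * K + (1 - \<rho> - lam) * real \<beta>"
    using pos by (simp add: B_def field_simps)
  with 1 2 have "(1 - lam) * real (Q (D v)) \<le> (1 - lam) * B"
    by (simp add: algebra_simps)
  moreover have "1 - lam > 0" using pos rho_pos by simp
  ultimately show ?case by (simp add: B_def K_def)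
qed

lemma stored_D_single:
  assumes "n = 1"
  shows "Q (D v) = 0"
proof -
  have "v mod n = 0" by (simp only: assms mod_by_1)
  then have "queue (st (D v)) 0 = []"
    using D_drained[of v] by (simp add: visit_drained_def)
  moreover have "{..<n} = {0}" using assms by auto
  ultimately show ?thesis by (simp add: stored_packets_def)
qed

section \<open>Waiting time of a packet\<close>

lemma new_packet_enqueued: "k < inject r i \<Longrightarrow> (r, i, k) \<in> set (queue (st (Suc r)) i)"
  by (simp add: queue_Suc new_packets_def)

lemma dequeued_heard:
  assumes "a \<le> b" "p \<in> set (queue (st a) i)" "p \<notin> set (queue (st b) i)"
  shows "\<exists>r \<ge> a. r < b \<and> heard n J inject jam r = Some p"
  using assms(1,3)
proof (induction b rule: dec_induct)
  case base
  then show ?case using assms(2) by simp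
next
  case (step m)
  show ?case
  proof (cases "p \<in> set (queue (st m) i)")
    case False
    then show ?thesis using step by (meson less_Suc_eq)
  next
    case True
    then have "i = token (st m)" "\<not> jam m" "\<not> silent (st m)" "p = hd (queue (st m) i)"
      using step.prems
      by (cases "queue (st m) i"; auto simp: queue_Suc split: if_splits)+
    then show ?thesis using step.hyps by (intro exI[of _ m]) (simp add: heard_eq)
  qed
qed

text \<open>Let \<open>v\<close> be the first visit of station \<open>i\<close> with
  \<open>r < D v\<close>. The queue is empty at \<open>D v\<close>, so the packet has been heard by
  then, while by minimality the previous visit was drained no later than \<open>r\<close>.\<close>

lemma packet_heard_in_cycle:
  assumes "i < n" "k < inject r i"
  shows "\<exists>r' v. r \<le> r' \<and> heard n J inject jam r' = Some (r, i, k) \<and>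
    r' - r + 1 \<le> D v - D (v - n)"
proof -
  define P where "P v \<longleftrightarrow> v mod n = i \<and> r < D v" for v
  \<comment> \<open>The index belongs to station \<open>i\<close> and is at least
    \<open>Suc r\<close>, while \<open>D\<close> increases by at least one per visit.\<close>
  have "r < D (i + n * Suc r)"
    using less_D[of r] D_mono[of "Suc r" "i + n * Suc r"] n_pos
    by (smt (verit) le_add2 le_trans mult_le_mono1 nat_mult_1 order_less_le_trans)
  then have "P (i + n * Suc r)" using assms(1) by (simp add: P_def del: mult_Suc_right)
  define v where "v = (LEAST v. P v)"
  have v: "P v" unfolding v_def by (rule LeastI) fact
  have "D (v - n) \<le> r"
  proof (cases "v < n")
    case True
    then show ?thesis by (simp add: D_0)
  next
    case False
    then have "\<not> P (v - n)" unfolding v_def using n_pos v not_less_Least[of "v - n" P]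
      by (simp add: v_def)
    moreover have "(v - n) mod n = i" using v False by (simp add: P_def le_mod_geq)
    ultimately show ?thesis by (simp add: P_def)
  qed
  have "queue (st (D v)) i = []"
    using D_drained[of v] v by (simp add: P_def visit_drained_def)
  then obtain r' where r': "Suc r \<le> r'" "r' < D v" "heard n J inject jam r' = Some (r, i, k)"
    using dequeued_heard[of "Suc r" "D v" "(r, i, k)" i] new_packet_enqueued[OF assms(2)] v
    by (auto simp: P_def Suc_le_eq)
  then show ?thesis using \<open>D (v - n) \<le> r\<close>
    by (intro exI[of _ r'] exI[of _ v]) auto
qed

lemma round_in_cycle: "\<exists>v. D (v - n) \<le> r \<and> r \<le> D v"
proof -
  define v where "v = (LEAST v. r \<le> D v)"
  have "r \<le> D v" unfolding v_def
    by (rule LeastI[of _ "Suc r"]) (use less_D[of r] in simp)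
  moreover have "D (v - n) \<le> r"
  proof (cases "v = 0")
    case True
    then show ?thesis by (simp add: D_0)
  next
    case False
    then have "\<not> r \<le> D (v - n)"
      using n_pos unfolding v_def by (intro not_less_Least) simp
    then show ?thesis by simp
  qed
  ultimately show ?thesis by blast
qed

text \<open>By \<open>cycle_stored_le\<close>, \<open>Q + K\<close> bounds both the store within a
  cycle and \<open>1 - \<rho> - lam\<close> times the length of the cycle. The hypothesis says that
  \<open>J\<close> is at most \<open>\<beta> / (1 - lam)\<close>, which removes \<open>J\<close>
  from the result.\<close>

lemma cycle_bounds:
  assumes J: "real J \<le> lam * real J + real \<beta>"
  defines "K \<equiv> 2 * real \<beta> + real n * (real J + 1)"
  shows "real (Q (D v)) + K \<le> 2 * (real \<beta> + 1) / (1 - \<rho> - lam) * real n + real \<beta>"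
    and "real (Q (D v)) + K
      \<le> 2 * (real \<beta> + 1) / ((1 - lam) * (1 - \<rho> - lam)) * real n + real \<beta> * (1 - lam)"
proof -
  define m where "m = 1 - lam"
  define d where "d = 1 - \<rho> - lam"
  define b where "b = real \<beta>"
  define N where "N = real n"
  define j where "j = real J"
  have d: "0 < d" "d \<le> m" "m < 1" "d \<le> 1" and b: "0 \<le> b" and N: "1 \<le> N"
    using rho_pos lam_pos rate n_pos by (auto simp: d_def m_def b_def N_def)
  then have m: "0 < m" by simp
  have Jm: "j * m \<le> b" using J by (simp add: j_def m_def b_def algebra_simps)
  then have "N * (j * m) \<le> N * b" using N by (intro mult_left_mono) auto
  then have Km: "K * m \<le> 2 * b * m + N * b + N * m"
    by (simp add: K_def algebra_simps flip: b_def N_def j_def)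
  have "(real (Q (D v)) + K) * d \<le> 2 * (b + 1) * N + b * d \<and>
    (real (Q (D v)) + K) * (m * d) \<le> 2 * (b + 1) * N + b * m * (m * d)"
  proof (cases "n = 1")
    case True
    then have Q: "real (Q (D v)) = 0" and N1: "N = 1"
      using stored_D_single by (auto simp: N_def)
    have "j * d \<le> b"
      using d Jm mult_left_mono[of d m j] by (simp add: j_def)
    moreover have "b * d + d \<le> b + 1"
      using d b mult_left_le[of d "b + 1"] by (simp add: algebra_simps)
    moreover have "K * d = 2 * (b * d) + j * d + d"
      using N1 by (simp add: K_def algebra_simps flip: b_def N_def j_def)
    ultimately have first: "K * d \<le> 2 * (b + 1) + b * d"
      using b by (simp add: algebra_simps)
    \<comment> \<open>Expanding the square gives
      \<open>2 * b * m + b - b * m * m \<le> 2 * b\<close>.\<close>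
    have "b * (1 - m)\<^sup>2 \<ge> 0" using b by simp
    then have "K * m - b * m * m \<le> 2 * b + m"
      using Km N1 by (simp add: power2_eq_square algebra_simps)
    then have "(K * m - b * m * m) * d \<le> (2 * b + m) * d"
      using d by (intro mult_right_mono) auto
    also have "\<dots> \<le> 2 * b + m" using d m b by (intro mult_left_le) auto
    finally have "K * (m * d) \<le> 2 * (b + 1) + b * m * (m * d)"
      using d by (simp add: algebra_simps)
    with first show ?thesis using Q N1 by simp
  next
    case False
    then have N2: "2 \<le> N" using n_pos by (simp add: N_def)
    have "real (Q (D v)) \<le> \<rho> * K / d + b"
      using stored_D_le by (simp add: K_def d_def b_def)
    then have "real (Q (D v)) * d \<le> \<rho> * K + b * d"
      using d by (simp add: field_simps)
    \<comment> \<open>Since \<open>\<rho> + d = m\<close>, adding \<open>K * d\<close> turns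
      \<open>\<rho> * K\<close> into \<open>K * m\<close>.\<close>
    moreover have "\<rho> * K = m * K - d * K" by (simp add: m_def d_def algebra_simps)
    ultimately have QK: "(real (Q (D v)) + K) * d \<le> K * m + b * d"
      by (simp add: algebra_simps)
    \<comment> \<open>With at least two stations the bursts \<open>2 * b\<close> are absorbed into
      the term linear in \<open>N\<close>.\<close>
    have "2 * b \<le> N * b" using N2 b by (intro mult_right_mono) auto
    then have "2 * b * m \<le> N * b * m" by (rule mult_right_mono) (use m in simp)
    then have Km': "K * m \<le> N * b * m + N * b + N * m" using Km by linarith
    have Nb: "N * b * m \<le> N * b" "N * m \<le> N"
      using N b d by (auto intro!: mult_left_le)
    have "2 * (b + 1) * N = 2 * (N * b) + 2 * N" by (simp add: algebra_simps)
    then have first: "(real (Q (D v)) + K) * d \<le> 2 * (b + 1) * N + b * d"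
      using QK Km' Nb N by linarith
    have "(real (Q (D v)) + K) * (m * d) \<le> (K * m + b * d) * m"
      using mult_right_mono[OF QK, of m] m by (simp add: mult.assoc mult.commute[of m])
    also have "\<dots> \<le> (N * b * m + N * b + N * m + b * d) * m"
      using Km' m by (intro mult_right_mono) auto
    \<comment> \<open>The additive term may keep only \<open>b * m * (m * d)\<close>. The excess
      \<open>b * d * (1 - m) * m\<close> is charged to the part linear in \<open>N\<close>.\<close>
    also have "\<dots> = (N * b * m + N * b + N * m) * m + b * d * (1 - m) * m + b * m * (m * d)"
      by (simp add: algebra_simps)
    also have "b * d * (1 - m) * m \<le> N * b * (1 - m) * m"
    proof -
      have "b * d \<le> b * N" using b d N by (intro mult_left_mono) auto
      then show ?thesis using d m by (intro mult_right_mono) (auto simp: mult.commute)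
    qed
    also have "(N * b * m + N * b + N * m) * m + N * b * (1 - m) * m = (2 * (N * b) + N * m) * m"
      by (simp add: algebra_simps)
    also have "\<dots> \<le> 2 * (N * b) + N * m"
      using d m b N by (intro mult_left_le) auto
    also have "\<dots> \<le> 2 * (b + 1) * N"
      using Nb N by (simp add: algebra_simps)
    finally show ?thesis using first by simp
  qed
  then have "real (Q (D v)) + K \<le> (2 * (b + 1) * N + b * d) / d"
    and "real (Q (D v)) + K \<le> (2 * (b + 1) * N + b * m * (m * d)) / (m * d)"
    using d m by (auto simp: pos_le_divide_eq)
  then show "real (Q (D v)) + K \<le> 2 * (real \<beta> + 1) / (1 - \<rho> - lam) * real n + real \<beta>"
    and "real (Q (D v)) + K
      \<le> 2 * (real \<beta> + 1) / ((1 - lam) * (1 - \<rho> - lam)) * real n + real \<beta> * (1 - lam)"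
    using d m by (simp_all add: add_divide_distrib[of "_ * N"] flip: m_def d_def b_def N_def)
qed

end

theorem theorem7:
  fixes n J \<beta> :: nat and \<rho> lam :: real
    and inject :: injections and jam :: jamming
  assumes "n \<ge> 1"
    and "\<rho> > 0" and "lam > 0" and "\<rho> + lam < 1" and "\<beta> \<ge> 1"
    and "adversary_of_type n \<rho> lam \<beta> inject jam"
    and "jamming_burstiness_at_most jam J"
    and "real J \<le> lam * real J + real \<beta>"
  shows "(\<forall>r. real (stored_packets n (jrrw n J inject jam r))
              \<le> 2 * (real \<beta> + 1) / (1 - \<rho> - lam) * real n + real \<beta>) \<and>
         packet_latency_at_most n J inject jam
           (2 * (real \<beta> + 1) / ((1 - lam) * (1 - \<rho> - lam)\<^sup>2) * real n
            + real \<beta> * (1 - lam) / (1 - \<rho> - lam))"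
proof -
  interpret jrrw_execution n J \<beta> \<rho> lam inject jam
    using assms by unfold_locales
  have pos: "1 - \<rho> - lam > 0" using assms by simp
  note bounds = cycle_bounds[OF assms(8)]
  have "real (Q r) \<le> 2 * (real \<beta> + 1) / (1 - \<rho> - lam) * real n + real \<beta>" for r
  proof -
    obtain v where v: "D (v - n) \<le> r" "r \<le> D v" using round_in_cycle by blast
    have "(1 - \<rho> - lam) * real (r - D (v - n)) \<ge> 0" using pos by simp
    then show ?thesis using cycle_stored_le[OF v] bounds(1)[of "v - n"] by linarith
  qed
  moreover have "\<exists>r' \<ge> r. heard n J inject jam r' = Some (r, i, k) \<and>
      real (r' - r + 1) \<le> 2 * (real \<beta> + 1) / ((1 - lam) * (1 - \<rho> - lam)\<^sup>2) * real n
        + real \<beta> * (1 - lam) / (1 - \<rho> - lam)"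
    if ik: "i < n" "k < inject r i" for r i k
  proof -
    obtain r' v where r': "r \<le> r'" "heard n J inject jam r' = Some (r, i, k)"
      "r' - r + 1 \<le> D v - D (v - n)"
      using packet_heard_in_cycle[where i = i and k = k and r = r] ik by blast
    \<comment> \<open>At the end of the cycle the store is nonnegative, so the drift over the whole
      cycle is at most \<open>Q + K\<close> at its start.\<close>
    have "(1 - \<rho> - lam) * real (D v - D (v - n))
        \<le> 2 * (real \<beta> + 1) / ((1 - lam) * (1 - \<rho> - lam)) * real n + real \<beta> * (1 - lam)"
      using cycle_stored_le[of v "D v"] D_mono[of "v - n" v] bounds(2)[of "v - n"] by simp
    then have "real (D v - D (v - n)) \<le>
        (2 * (real \<beta> + 1) / ((1 - lam) * (1 - \<rho> - lam)) * real n + real \<beta> * (1 - lam))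
          / (1 - \<rho> - lam)"
      using pos by (simp add: pos_le_divide_eq mult.commute)
    also have "\<dots> = 2 * (real \<beta> + 1) / ((1 - lam) * (1 - \<rho> - lam)\<^sup>2) * real n
        + real \<beta> * (1 - lam) / (1 - \<rho> - lam)"
      by (simp add: add_divide_distrib power2_eq_square divide_divide_eq_left mult.assoc
          flip: times_divide_eq_left del: times_divide_eq_right)
    finally show ?thesis using r' by (intro exI[of _ r']) linarith
  qed
  ultimately show ?thesis by (simp add: packet_latency_at_most_def)
qed

end
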